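(* Let $2<p<\infty$ and let $X$, $Y$ be Banach spaces. (i) If $T:Y\to X$ is an operator such that $JT:Y\to\ell_p$ is compact for all operators $J:X\to\ell_p$, then $T$ is weakly precompact. (ii) If $T:Y\to X$ is an operator such that $T^*:X^*\to Y^*$ is $p$-convergent, then $T$ is weakly precompact.
   Context: Operators are continuous linear maps between Banach spaces. A sequence $(x_n)$ in a Banach space $E$ is weakly $p$-summable if $(x^*(x_n))_n\in\ell_p$ for every $x^*\in E^*$. An operator is $p$-convergent if it maps weakly $p$-summable sequences to norm null sequences. An operator $T:Y\to X$ is weakly precompact if every sequence in $T(B_Y)$ ($B_Y$ the unit ball of $Y$) has a weakly Cauchy subsequence. *)

theory Defs
  imports "HOL-Analysis.Analysis"
begin

text \<open>The exponent is a real-valued parameter, so the sequence space is a carrier set with a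
  metric, and its topology is the metric topology of the library.\<close>

definition lp_space :: "real \<Rightarrow> (nat \<Rightarrow> real) set" where
  "lp_space p = {x. summable (\<lambda>n. \<bar>x n\<bar> powr p)}"

definition lp_norm :: "real \<Rightarrow> (nat \<Rightarrow> real) \<Rightarrow> real" where
  "lp_norm p x = (\<Sum>n. \<bar>x n\<bar> powr p) powr (1 / p)"

definition lp_dist :: "real \<Rightarrow> (nat \<Rightarrow> real) \<Rightarrow> (nat \<Rightarrow> real) \<Rightarrow> real" where
  "lp_dist p x y = lp_norm p (\<lambda>n. x n - y n)"

definition lp_topology :: "real \<Rightarrow> (nat \<Rightarrow> real) topology" where
  "lp_topology p = Metric_space.mtopology (lp_space p) (lp_dist p)"

lemma powr_convex_combination:
  fixes a b t p :: real
  assumes "1 \<le> p" "0 \<le> a" "0 \<le> b" "0 \<le> t" "t \<le> 1"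
  shows "(t * a + (1 - t) * b) powr p \<le> t * a powr p + (1 - t) * b powr p"
proof -
  have *: "(s * c) powr p \<le> s * c powr p" if "0 \<le> s" "s \<le> 1" "0 \<le> c" for s c :: real
  proof -
    have "s powr p \<le> s"
      using powr_mono'[of 1 p s] that assms(1) by (cases "s = 0") auto
    then show ?thesis
      using that by (simp add: powr_mult mult_right_mono)
  qed
  consider "a = 0" | "b = 0" | "a > 0" "b > 0" using assms by linarith
  then show ?thesis
  proof cases
    case 1 then show ?thesis using *[of "1 - t" b] assms by simp
  next
    case 2 then show ?thesis using *[of t a] assms by simp
  next
    case 3
    then show ?thesis
      using convex_onD[OF powr_convex[OF assms(1)], of "1 - t" a b] assms by simp
  qed
qed

lemma lp_norm_nonneg: "0 \<le> lp_norm p x"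
  by (simp add: lp_norm_def)

lemma lp_norm_powr:
  assumes "1 \<le> p" "x \<in> lp_space p"
  shows "lp_norm p x powr p = (\<Sum>n. \<bar>x n\<bar> powr p)"
  using assms by (simp add: lp_norm_def lp_space_def powr_powr suminf_nonneg)

lemma lp_norm_eq_0_iff:
  assumes "1 \<le> p" "x \<in> lp_space p"
  shows "lp_norm p x = 0 \<longleftrightarrow> x = (\<lambda>n. 0)"
  using assms suminf_eq_zero_iff[of "\<lambda>n. \<bar>x n\<bar> powr p"]
  by (auto simp: lp_norm_def lp_space_def fun_eq_iff)

lemma lp_minkowski:
  assumes p: "1 \<le> p" and x: "x \<in> lp_space p" and y: "y \<in> lp_space p"
  shows "(\<lambda>n. x n + y n) \<in> lp_space p"
    and "lp_norm p (\<lambda>n. x n + y n) \<le> lp_norm p x + lp_norm p y"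
proof -
  have "(\<lambda>n. x n + y n) \<in> lp_space p \<and> lp_norm p (\<lambda>n. x n + y n) \<le> lp_norm p x + lp_norm p y"
  proof (cases "lp_norm p x = 0 \<or> lp_norm p y = 0")
    case True
    then show ?thesis
      using lp_norm_eq_0_iff[OF p x] lp_norm_eq_0_iff[OF p y] x y lp_norm_nonneg by auto
  next
    case False
    define A B where "A = lp_norm p x" and "B = lp_norm p y"
    have AB: "A > 0" "B > 0"
      using False lp_norm_nonneg[of p x] lp_norm_nonneg[of p y] unfolding A_def B_def by linarith+
    define t where "t = A / (A + B)"
    have t: "0 \<le> t" "t \<le> 1" "1 - t = B / (A + B)" using AB by (auto simp: t_def field_simps)
    define f where "f n = (A + B) powr p *
      (t * (\<bar>x n\<bar> powr p / A powr p) + (1 - t) * (\<bar>y n\<bar> powr p / B powr p))" for n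
    have le: "\<bar>x n + y n\<bar> powr p \<le> f n" for n
    proof -
      have "\<bar>x n + y n\<bar> \<le> \<bar>x n\<bar> + \<bar>y n\<bar>" by simp
      also have "\<dots> = (A + B) * (t * (\<bar>x n\<bar> / A) + (1 - t) * (\<bar>y n\<bar> / B))"
      proof -
        have "(A + B) * t = A" "(A + B) * (1 - t) = B"
          unfolding t(3) using AB by (simp_all add: t_def)
        then have eq: "(A + B) * (t * c + (1 - t) * d) = A * c + B * d" for c d
          by (metis distrib_left mult.assoc)
        show ?thesis unfolding eq using AB by simp
      qed
      finally have "\<bar>x n + y n\<bar> powr p \<le>
          ((A + B) * (t * (\<bar>x n\<bar> / A) + (1 - t) * (\<bar>y n\<bar> / B))) powr p"
        using p by (intro powr_mono2) auto
      also have "\<dots> = (A + B) powr p * (t * (\<bar>x n\<bar> / A) + (1 - t) * (\<bar>y n\<bar> / B)) powr p"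
        using AB t by (simp add: powr_mult)
      also have "\<dots> \<le> (A + B) powr p * (t * (\<bar>x n\<bar> / A) powr p + (1 - t) * (\<bar>y n\<bar> / B) powr p)"
        using AB t p by (intro mult_left_mono powr_convex_combination) auto
      finally show ?thesis using AB by (simp add: f_def powr_divide)
    qed
    have sx: "(\<lambda>n. \<bar>x n\<bar> powr p) sums (A powr p)"
      using x by (simp add: A_def lp_norm_powr[OF p x] lp_space_def summable_sums)
    have sy: "(\<lambda>n. \<bar>y n\<bar> powr p) sums (B powr p)"
      using y by (simp add: B_def lp_norm_powr[OF p y] lp_space_def summable_sums)
    have "f sums ((A + B) powr p *
      (t * (A powr p / A powr p) + (1 - t) * (B powr p / B powr p)))"
      unfolding f_def by (intro sums_mult sums_add sums_divide sx sy)
    then have f: "f sums ((A + B) powr p)" using AB by simp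
    have sum: "summable (\<lambda>n. \<bar>x n + y n\<bar> powr p)"
      using le by (intro summable_comparison_test'[OF sums_summable[OF f]]) auto
    have "(\<Sum>n. \<bar>x n + y n\<bar> powr p) \<le> (A + B) powr p"
      using suminf_le[OF le sum sums_summable[OF f]] sums_unique[OF f] by simp
    then have "lp_norm p (\<lambda>n. x n + y n) \<le> ((A + B) powr p) powr (1 / p)"
      unfolding lp_norm_def using p sum by (intro powr_mono2) (auto intro: suminf_nonneg)
    also have "\<dots> = A + B" using p AB by (simp add: powr_powr)
    finally show ?thesis using sum by (simp add: lp_space_def A_def B_def)
  qed
  then show "(\<lambda>n. x n + y n) \<in> lp_space p"
    "lp_norm p (\<lambda>n. x n + y n) \<le> lp_norm p x + lp_norm p y" by auto
qed

lemma lp_space_diff: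
  assumes "1 \<le> p" "x \<in> lp_space p" "y \<in> lp_space p"
  shows "(\<lambda>n. x n - y n) \<in> lp_space p"
  using lp_minkowski(1)[of p x "\<lambda>n. - y n"] assms by (simp add: lp_space_def)

lemma Metric_space_lp:
  assumes "1 \<le> p"
  shows "Metric_space (lp_space p) (lp_dist p)"
proof
  show "0 \<le> lp_dist p x y" for x y by (simp add: lp_dist_def lp_norm_nonneg)
  show "lp_dist p x y = lp_dist p y x" for x y
    by (simp add: lp_dist_def lp_norm_def abs_minus_commute)
  show "lp_dist p x y = 0 \<longleftrightarrow> x = y" if "x \<in> lp_space p" "y \<in> lp_space p" for x y
    using lp_norm_eq_0_iff[OF assms lp_space_diff[OF assms that]]
    by (simp add: lp_dist_def fun_eq_iff)
  show "lp_dist p x z \<le> lp_dist p x y + lp_dist p y z"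
    if "x \<in> lp_space p" "y \<in> lp_space p" "z \<in> lp_space p" for x y z
    using lp_minkowski(2)[OF assms lp_space_diff[OF assms that(1,2)] lp_space_diff[OF assms that(2,3)]]
    by (simp add: lp_dist_def)
qed

lemma topspace_lp_topology: "1 \<le> p \<Longrightarrow> topspace (lp_topology p) = lp_space p"
  by (simp add: lp_topology_def Metric_space.topspace_mtopology Metric_space_lp)

text \<open>Linearity of a map into the sequence space is coordinatewise linearity, since the vector
  space operations on sequences are pointwise.\<close>

definition lp_operator :: "real \<Rightarrow> ('a::real_normed_vector \<Rightarrow> nat \<Rightarrow> real) \<Rightarrow> bool" where
  "lp_operator p J \<longleftrightarrow> (\<forall>n. linear (\<lambda>x. J x n)) \<and> continuous_map euclidean (lp_topology p) J"

definition lp_compact :: "real \<Rightarrow> ('a::real_normed_vector \<Rightarrow> nat \<Rightarrow> real) \<Rightarrow> bool" where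
  "lp_compact p S \<longleftrightarrow>
     compactin (lp_topology p) ((lp_topology p) closure_of (S ` cball 0 1))"

definition weakly_Cauchy :: "(nat \<Rightarrow> 'a::real_normed_vector) \<Rightarrow> bool" where
  "weakly_Cauchy x \<longleftrightarrow> (\<forall>\<phi> :: 'a \<Rightarrow>\<^sub>L real. Cauchy (\<lambda>n. \<phi> (x n)))"

definition weakly_precompact ::
    "('a::real_normed_vector \<Rightarrow>\<^sub>L 'b::real_normed_vector) \<Rightarrow> bool" where
  "weakly_precompact T \<longleftrightarrow>
     (\<forall>x. range x \<subseteq> T ` cball 0 1 \<longrightarrow> (\<exists>r. strict_mono (r :: nat \<Rightarrow> nat) \<and> weakly_Cauchy (x \<circ> r)))"

definition weakly_p_summable :: "real \<Rightarrow> (nat \<Rightarrow> 'a::real_normed_vector) \<Rightarrow> bool" where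
  "weakly_p_summable p x \<longleftrightarrow> (\<forall>\<phi> :: 'a \<Rightarrow>\<^sub>L real. (\<lambda>n. \<phi> (x n)) \<in> lp_space p)"

definition p_convergent ::
    "real \<Rightarrow> ('a::real_normed_vector \<Rightarrow>\<^sub>L 'b::real_normed_vector) \<Rightarrow> bool" where
  "p_convergent p T \<longleftrightarrow> (\<forall>x. weakly_p_summable p x \<longrightarrow> (\<lambda>n. T (x n)) \<longlonglongrightarrow> 0)"

lift_definition banach_adjoint ::
    "('a::real_normed_vector \<Rightarrow>\<^sub>L 'b::real_normed_vector) \<Rightarrow> ('b \<Rightarrow>\<^sub>L real) \<Rightarrow>\<^sub>L ('a \<Rightarrow>\<^sub>L real)"
  is "\<lambda>T \<phi>. \<phi> o\<^sub>L T"
  by (rule bounded_bilinear.bounded_linear_left[OF bounded_bilinear_blinfun_compose])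

end

theory Submission
  imports Defs "HOL-Library.Diagonal_Subsequence"
begin

text \<open>If \<open>T\<close> is not weakly precompact, choose \<open>x\<^sub>n = T y\<^sub>n\<close> with \<open>\<parallel>y\<^sub>n\<parallel> \<le> 1\<close> and no weakly Cauchy
  subsequence. Rosenthal's combinatorial argument yields \<open>r < s\<close> and a subsequence such that every
  finite sign pattern \<open>\<epsilon>\<close> is realised by some \<open>\<psi>\<^sub>\<epsilon>\<close> in the dual unit ball, with \<open>\<psi>\<^sub>\<epsilon>(x\<^sub>n) > s\<close> where
  \<open>\<epsilon>\<^sub>n = 1\<close> and \<open>\<psi>\<^sub>\<epsilon>(x\<^sub>n) < r\<close> where \<open>\<epsilon>\<^sub>n = -1\<close>. The averages \<open>\<phi>\<^sub>n\<close> of \<open>\<epsilon>\<^sub>n \<psi>\<^sub>\<epsilon>\<close> over all \<open>\<epsilon>\<close> satisfy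
  \<open>\<phi>\<^sub>n(x\<^sub>n) \<ge> (s - r)/2\<close> and, by Bessel's inequality for the Rademacher functions,
  \<open>\<Sum>\<^sub>n \<phi>\<^sub>n(z)\<^sup>2 \<le> \<parallel>z\<parallel>\<^sup>2\<close>. Compactness passes from finitely many \<open>\<phi>\<^sub>n\<close> to a sequence, which is weakly
  2-summable, hence weakly \<open>p\<close>-summable. It contradicts the hypothesis of (ii) directly, and that
  of (i) through \<open>J z = (\<phi>\<^sub>n(z))\<^sub>n\<close>.\<close>

section \<open>Independent subsequences\<close>

text \<open>In the application \<open>A n\<close> and \<open>B n\<close> hold the functionals above
  \<open>s\<close>, respectively below \<open>r\<close>, at \<open>x n\<close>. Asking for a witness
  on every infinite subset of \<open>M\<close>, not on \<open>M\<close> alone, makes the property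
  hereditary, so \<open>M\<close> can be thinned repeatedly.\<close>

definition oscillates :: "(nat \<Rightarrow> 'a set) \<Rightarrow> (nat \<Rightarrow> 'a set) \<Rightarrow> nat set \<Rightarrow> 'a set \<Rightarrow> bool" where
  "oscillates A B M S \<longleftrightarrow>
     (\<forall>N\<subseteq>M. infinite N \<longrightarrow> (\<exists>u\<in>S. infinite {n\<in>N. u \<in> A n} \<and> infinite {n\<in>N. u \<in> B n}))"

lemma oscillates_mono: "oscillates A B M S \<Longrightarrow> M' \<subseteq> M \<Longrightarrow> oscillates A B M' S"
  unfolding oscillates_def by blast

lemma infinite_Int_greaterThan:
  fixes M :: "nat set"
  assumes "infinite M"
  shows "infinite (M \<inter> {j<..})"
proof
  assume "finite (M \<inter> {j<..})"
  then have "finite ((M \<inter> {j<..}) \<union> {..j})" by simp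
  moreover have "M \<subseteq> (M \<inter> {j<..}) \<union> {..j}" by auto
  ultimately show False
    using assms finite_subset by blast
qed

text \<open>If every choice of \<open>j\<close> failed, one could pick \<open>j\<^sub>0 < j\<^sub>1 < \<dots>\<close> and shrinking index sets witnessing
  the failures; infinitely many of them concern the same \<open>S\<close> and the same side, and the
  corresponding \<open>j\<^sub>k\<close> form a subsequence that does not oscillate on \<open>S\<close>.\<close>

lemma oscillates_split:
  assumes fin: "finite \<X>" and inf: "infinite M"
    and osc: "\<And>S. S \<in> \<X> \<Longrightarrow> oscillates A B M S"
  shows "\<exists>j\<in>M. \<exists>M'\<subseteq>M. infinite M' \<and>
    (\<forall>S\<in>\<X>. oscillates A B M' (S \<inter> A j) \<and> oscillates A B M' (S \<inter> B j))"
proof (rule ccontr)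
  assume neg: "\<not> ?thesis"
  define C where "C b = (if b then A else B)" for b
  define tame where
    "tame N S \<longleftrightarrow> (\<forall>u\<in>S. finite {n\<in>N. u \<in> A n} \<or> finite {n\<in>N. u \<in> B n})" for N S
  have step: "\<exists>N S b. N \<subseteq> M' \<and> infinite N \<and> S \<in> \<X> \<and> tame N (S \<inter> C b j)"
    if j: "j \<in> M" and M': "M' \<subseteq> M" "infinite M'" for j M'
  proof -
    obtain S where S: "S \<in> \<X>" "\<not> (oscillates A B M' (S \<inter> A j) \<and> oscillates A B M' (S \<inter> B j))"
      using neg j M' by blast
    then obtain b where "\<not> oscillates A B M' (S \<inter> C b j)"
      unfolding C_def by (metis (full_types))
    then show ?thesis
      using S(1) unfolding oscillates_def tame_def by blast
  qed
  \<comment> \<open>A state holds an index \<open>j\<close> and a set \<open>N\<close> of later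
    indices witnessing failure on \<open>S \<inter> C b j\<close>. \<open>Q\<close> takes the next
    index from \<open>N\<close> and shrinks \<open>N\<close>, so each failure stays in force for all
    later indices.\<close>
  define P where "P = (\<lambda>(_::nat) (j, N, S, b). j \<in> M \<and> N \<subseteq> M \<inter> {j<..} \<and> infinite N \<and>
    S \<in> \<X> \<and> tame N (S \<inter> C b j))"
  define Q where "Q = (\<lambda>(_::nat) (j::nat, N::nat set, S::'a set, b::bool) (j', N', S'::'a set, b'::bool).
    j' \<in> N \<and> N' \<subseteq> N)"
  have "\<exists>f. \<forall>n. P n (f n) \<and> Q n (f n) (f (Suc n))"
  proof (rule dependent_nat_choice)
    obtain j where j: "j \<in> M" using inf by (metis finite.emptyI ex_in_conv)
    with step[OF j Int_lower1 infinite_Int_greaterThan[OF inf, of j]]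
    show "\<exists>x. P 0 x" unfolding P_def by auto
  next
    fix x n assume "P n x"
    obtain j N S b where x: "x = (j, N, S, b)" by (cases x) auto
    with \<open>P n x\<close> have N: "N \<subseteq> M" "infinite N" by (auto simp: P_def)
    obtain j' where j': "j' \<in> N" using N by (metis finite.emptyI ex_in_conv)
    obtain N' S' b' where "N' \<subseteq> N \<inter> {j'<..}" "infinite N'" "S' \<in> \<X>" "tame N' (S' \<inter> C b' j')"
      using step[of j' "N \<inter> {j'<..}"] j' N infinite_Int_greaterThan[OF N(2), of j'] by blast
    then have "P (Suc n) (j', N', S', b') \<and> Q n x (j', N', S', b')"
      using j' N by (auto simp: P_def Q_def x)
    then show "\<exists>y. P (Suc n) y \<and> Q n x y" by blast
  qed
  then obtain f where f: "\<And>n. P n (f n)" "\<And>n. Q n (f n) (f (Suc n))" by blast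
  define j N S b where "j n = fst (f n)" and "N n = fst (snd (f n))"
    and "S n = fst (snd (snd (f n)))" and "b n = snd (snd (snd (f n)))" for n
  have feq: "f n = (j n, N n, S n, b n)" for n
    by (simp add: j_def N_def S_def b_def)
  have P: "j n \<in> M" "N n \<subseteq> M" "N n \<subseteq> {j n<..}" "S n \<in> \<X>" "tame (N n) (S n \<inter> C (b n) (j n))" for n
    using f(1)[of n] unfolding feq P_def by auto
  have Q: "j (Suc n) \<in> N n" "N (Suc n) \<subseteq> N n" for n
    using f(2)[of n] unfolding feq Q_def by auto
  have mono: "strict_mono j"
    unfolding strict_mono_Suc_iff using P(3) Q(1) by blast
  have Nmono: "N m \<subseteq> N n" if "n \<le> m" for m n
    using lift_Suc_antimono_le[of N, OF Q(2) that] .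
  have jN: "j m \<in> N n" if "n < m" for m n
    using Q(1)[of "m - 1"] Nmono[of n "m - 1"] that
    by (cases m) auto
  have "finite ((\<lambda>n. (S n, b n)) ` UNIV)"
    by (rule finite_subset[of _ "\<X> \<times> UNIV"]) (use P(4) fin in auto)
  from pigeonhole_infinite[OF infinite_UNIV_nat this]
  obtain k0 where "infinite {n. (S n, b n) = (S k0, b k0)}" by auto
  define L where "L = {n. (S n, b n) = (S k0, b k0)}"
  have L: "infinite L" "\<And>n. n \<in> L \<Longrightarrow> S n = S k0 \<and> b n = b k0"
    using \<open>infinite {n. (S n, b n) = (S k0, b k0)}\<close> by (auto simp: L_def)
  have "infinite (j ` L)"
    using L(1) finite_imageD strict_mono_imp_inj_on[OF mono] inj_on_subset by blast
  moreover have "j ` L \<subseteq> M" using P(1) by auto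
  ultimately obtain u where u: "u \<in> S k0" "infinite {n\<in>j ` L. u \<in> A n}" "infinite {n\<in>j ` L. u \<in> B n}"
    using osc[OF P(4)[of k0]] unfolding oscillates_def by meson
  \<comment> \<open>If \<open>u\<close> lies on the common side at some \<open>j k\<close>, tameness
    of \<open>N k\<close> applies to \<open>u\<close>, yet \<open>N k\<close> contains all but
    finitely many indices of the subsequence. Otherwise \<open>u\<close> meets that side nowhere on
    the subsequence.\<close>
  show False
  proof (cases "\<exists>k\<in>L. u \<in> C (b k0) (j k)")
    case True
    then obtain k where k: "k \<in> L" "u \<in> C (b k0) (j k)" by blast
    then have "finite {n\<in>N k. u \<in> A n} \<or> finite {n\<in>N k. u \<in> B n}"
      using P(5)[of k] L(2)[of k] u(1) unfolding tame_def by auto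
    moreover have "{n\<in>j ` L. u \<in> D n} \<subseteq> {n\<in>N k. u \<in> D n} \<union> j ` {..k}" for D
      using jN[of k] by (auto simp: not_le[symmetric])
    ultimately show False
      using u(2,3) by (meson finite_UnI finite_atMost finite_imageI finite_subset)
  next
    case False
    then have "{n\<in>j ` L. u \<in> C (b k0) n} = {}" by auto
    then have "finite {n\<in>j ` L. u \<in> C (b k0) n}" by (simp only: finite.emptyI)
    then show False using u(2,3) by (auto simp: C_def split: if_splits)
  qed
qed

text \<open>After \<open>n\<close> rounds of splitting, the family holds the intersections of
  \<open>K\<close> along all patterns of length \<open>n\<close>. Each member still oscillates on an
  infinite index set, which forces it to be nonempty.\<close>

lemma oscillates_imp_independent:
  assumes inf: "infinite M" and osc: "oscillates A B M K"
  shows "\<exists>m :: nat \<Rightarrow> nat. strict_mono m \<and>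
    (\<forall>N \<sigma>. K \<inter> (\<Inter>i<N. if \<sigma> i then A (m i) else B (m i)) \<noteq> {})"
proof -
  define P where "P = (\<lambda>(_::nat) (\<X>, M, j::nat). finite \<X> \<and> infinite M \<and> M \<subseteq> {j<..} \<and>
    (\<forall>S\<in>\<X>. oscillates A B M S))"
  define Q where "Q = (\<lambda>(_::nat) (\<X>, M::nat set, j::nat) (\<X>', M'::nat set, j').
    j < j' \<and> \<X>' = (\<lambda>S. S \<inter> A j') ` \<X> \<union> (\<lambda>S. S \<inter> B j') ` \<X>)"
  \<comment> \<open>The clause for \<open>n = 0\<close> pins the recursion to the start
    \<open>{K}\<close>, which anchors the induction on \<open>N\<close> below.\<close>
  have "\<exists>f. \<forall>n. (P n (f n) \<and> (n = 0 \<longrightarrow> fst (f n) = {K})) \<and> Q n (f n) (f (Suc n))"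
  proof (rule dependent_nat_choice)
    have "P 0 ({K}, M \<inter> {0<..}, 0)"
      using inf osc oscillates_mono[OF osc, of "M \<inter> {0<..}"] infinite_Int_greaterThan[OF inf, of 0]
      by (auto simp: P_def)
    then show "\<exists>x. P 0 x \<and> (0 = (0::nat) \<longrightarrow> fst x = {K})" by (metis fst_conv)
  next
    fix x n assume "P n x \<and> (n = 0 \<longrightarrow> fst x = {K})"
    then have "P n x" ..
    obtain \<X> M j where x: "x = (\<X>, M, j)" by (cases x) auto
    have \<X>: "finite \<X>" "infinite M" "M \<subseteq> {j<..}" "\<And>S. S \<in> \<X> \<Longrightarrow> oscillates A B M S"
      using \<open>P n x\<close> by (auto simp: P_def x)
    from oscillates_split[OF \<X>(1,2,4)] obtain j' M' where j': "j' \<in> M" "M' \<subseteq> M" "infinite M'"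
      "\<And>S. S \<in> \<X> \<Longrightarrow> oscillates A B M' (S \<inter> A j') \<and> oscillates A B M' (S \<inter> B j')"
      by blast
    define \<X>' where "\<X>' = (\<lambda>S. S \<inter> A j') ` \<X> \<union> (\<lambda>S. S \<inter> B j') ` \<X>"
    have "P (Suc n) (\<X>', M' \<inter> {j'<..}, j')"
      using \<X>(1) infinite_Int_greaterThan[OF j'(3), of j'] j'(4)
      by (auto simp: P_def \<X>'_def intro: oscillates_mono)
    moreover have "Q n x (\<X>', M' \<inter> {j'<..}, j')"
      using j'(1) \<X>(3) by (auto simp: Q_def \<X>'_def x)
    ultimately show "\<exists>y. (P (Suc n) y \<and> (Suc n = 0 \<longrightarrow> fst y = {K})) \<and> Q n x y" by blast
  qed
  then obtain f where f: "\<And>n. P n (f n)" "fst (f 0) = {K}" "\<And>n. Q n (f n) (f (Suc n))" by blast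
  define \<X> M' j where "\<X> n = fst (f n)" and "M' n = fst (snd (f n))" and "j n = snd (snd (f n))" for n
  have feq: "f n = (\<X> n, M' n, j n)" for n
    by (simp add: \<X>_def M'_def j_def)
  have P: "infinite (M' n)" "S \<in> \<X> n \<Longrightarrow> oscillates A B (M' n) S" for n S
    using f(1)[of n] unfolding feq P_def by auto
  have Q: "j n < j (Suc n)"
    "\<X> (Suc n) = (\<lambda>S. S \<inter> A (j (Suc n))) ` \<X> n \<union> (\<lambda>S. S \<inter> B (j (Suc n))) ` \<X> n" for n
    using f(3)[of n] unfolding feq Q_def by auto
  show ?thesis
  proof (intro exI conjI allI)
    \<comment> \<open>\<open>j 0\<close> belongs to the initial state only; the first index that
      splits the family is \<open>j 1\<close>.\<close>
    show "strict_mono (\<lambda>n. j (Suc n))"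
      unfolding strict_mono_Suc_iff using Q(1) by blast
    fix N and \<sigma> :: "nat \<Rightarrow> bool"
    have "K \<inter> (\<Inter>i<N. if \<sigma> i then A (j (Suc i)) else B (j (Suc i))) \<in> \<X> N"
    proof (induction N)
      case 0
      then show ?case using f(2) by (simp add: \<X>_def)
    next
      case (Suc N)
      have "K \<inter> (\<Inter>i<Suc N. if \<sigma> i then A (j (Suc i)) else B (j (Suc i))) =
          (K \<inter> (\<Inter>i<N. if \<sigma> i then A (j (Suc i)) else B (j (Suc i)))) \<inter>
          (if \<sigma> N then A (j (Suc N)) else B (j (Suc N)))"
        by (simp add: lessThan_Suc Int_ac)
      then show ?case
        using Suc.IH unfolding Q(2) by (simp add: image_iff) blast
    qed
    from P(2)[OF this] show "K \<inter> (\<Inter>i<N. if \<sigma> i then A (j (Suc i)) else B (j (Suc i))) \<noteq> {}"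
      using P(1)[of N] unfolding oscillates_def by blast
  qed
qed

section \<open>Sequences without weakly Cauchy subsequences\<close>

text \<open>Boundedness gives a subsequential limit \<open>l\<close>. Terms far from
  \<open>l\<close> infinitely often would make the sequence oscillate across a rational gap on one
  side of \<open>l\<close>. Rational gaps suffice and are countable, as the diagonal argument below
  requires.\<close>

lemma convergent_if_no_rational_oscillation:
  fixes y :: "nat \<Rightarrow> real"
  assumes bdd: "bounded (range y)"
    and fin: "\<And>r s :: rat. r < s \<Longrightarrow> finite {n. of_rat s < y n} \<or> finite {n. y n < of_rat r}"
  shows "convergent y"
proof -
  obtain l \<rho> where l: "strict_mono (\<rho> :: nat \<Rightarrow> nat)" "(y \<circ> \<rho>) \<longlonglongrightarrow> l"
    using bounded_imp_convergent_subsequence[OF bdd] by blast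
  have near: "infinite {n. \<bar>y n - l\<bar> < e}" if "e > 0" for e
  proof -
    obtain n0 where n0: "\<And>n. n \<ge> n0 \<Longrightarrow> \<bar>y (\<rho> n) - l\<bar> < e"
      using l(2) \<open>e > 0\<close> unfolding LIMSEQ_def by (auto simp: dist_real_def)
    have "infinite (\<rho> ` {n0..})"
      using finite_imageD inj_on_subset[OF strict_mono_imp_inj_on[OF l(1)]] infinite_Ici by blast
    then show ?thesis using n0 by (auto elim!: infinite_super[rotated])
  qed
  have "y \<longlonglongrightarrow> l"
    unfolding LIMSEQ_def
  proof (intro allI impI)
    fix e :: real assume "e > 0"
    \<comment> \<open>The gap \<open>s2 < s1\<close> lies above \<open>l\<close>, the gap
      \<open>r1 < r2\<close> below it. Infinitely many terms are on the near side of each, so only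
      finitely many pass the far side.\<close>
    obtain s1 s2 where s: "l + e/2 < of_rat s1" "real_of_rat s1 < l + e"
        "l + e/4 < of_rat s2" "real_of_rat s2 < l + e/2"
      using of_rat_dense[of "l + e/2" "l + e"] of_rat_dense[of "l + e/4" "l + e/2"] \<open>e > 0\<close> by auto
    obtain r1 r2 where r: "l - e < of_rat r1" "real_of_rat r1 < l - e/2"
        "l - e/2 < of_rat r2" "real_of_rat r2 < l - e/4"
      using of_rat_dense[of "l - e" "l - e/2"] of_rat_dense[of "l - e/2" "l - e/4"] \<open>e > 0\<close> by auto
    have "s2 < s1" "r1 < r2"
      using s r by (simp_all flip: of_rat_less[where 'a = real])
    have "{n. \<bar>y n - l\<bar> < e/4} \<subseteq> {n. y n < of_rat s2}" "{n. \<bar>y n - l\<bar> < e/4} \<subseteq> {n. of_rat r2 < y n}"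
      using s r by (auto simp only: mem_Collect_eq subset_iff abs_less_iff)
    then have "infinite {n. y n < of_rat s2}" "infinite {n. of_rat r2 < y n}"
      using near[of "e/4"] \<open>e > 0\<close> infinite_super by auto
    then have "finite {n. of_rat s1 < y n}" "finite {n. y n < of_rat r1}"
      using fin[OF \<open>s2 < s1\<close>] fin[OF \<open>r1 < r2\<close>] by auto
    then have "finite ({n. of_rat s1 < y n} \<union> {n. y n < of_rat r1})" by simp
    moreover have "{n. e \<le> \<bar>y n - l\<bar>} \<subseteq> {n. of_rat s1 < y n} \<union> {n. y n < of_rat r1}"
      using s r by auto
    ultimately have "finite {n. e \<le> \<bar>y n - l\<bar>}" by (rule rev_finite_subset)
    then obtain n0 where "\<And>n. e \<le> \<bar>y n - l\<bar> \<Longrightarrow> n < n0"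
      unfolding finite_nat_set_iff_bounded by auto
    then show "\<exists>n0. \<forall>n\<ge>n0. dist (y n) l < e"
      by (intro exI[of _ n0]) (force simp: dist_real_def not_le[symmetric])
  qed
  then show ?thesis by (rule convergentI)
qed

text \<open>If no gap oscillates, each rational gap can be settled by a subsequence on which every
  functional of the unit ball is eventually at most \<open>s\<close> or eventually at least
  \<open>r\<close>. The diagonal of these subsequences is then weakly Cauchy.\<close>

lemma no_weakly_Cauchy_imp_oscillates:
  fixes x :: "nat \<Rightarrow> 'a::real_normed_vector"
  assumes bdd: "bounded (range x)"
    and no: "\<And>t. strict_mono (t :: nat \<Rightarrow> nat) \<Longrightarrow> \<not> weakly_Cauchy (x \<circ> t)"
  obtains r s :: real and M where "r < s" "infinite M"
    "oscillates (\<lambda>n. {\<phi>. s < blinfun_apply \<phi> (x n)}) (\<lambda>n. {\<phi>. blinfun_apply \<phi> (x n) < r}) M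
      {\<phi> :: 'a \<Rightarrow>\<^sub>L real. norm \<phi> \<le> 1}"
proof (rule ccontr)
  assume neg: "\<not> thesis"
  define P where "P k t \<longleftrightarrow> (\<forall>r s. from_nat k = (r::rat, s::rat) \<longrightarrow> r < s \<longrightarrow>
      (\<forall>\<phi> :: 'a \<Rightarrow>\<^sub>L real. norm \<phi> \<le> 1 \<longrightarrow>
        finite {n. of_rat s < blinfun_apply \<phi> (x (t n))} \<or> finite {n. blinfun_apply \<phi> (x (t n)) < of_rat r}))"
    for k and t :: "nat \<Rightarrow> nat"
  have fin_pre: "finite {n. R (x (t (u n)))}"
    if "finite {n. R (x (t n))}" "strict_mono u" for R t and u :: "nat \<Rightarrow> nat"
    using finite_vimageI[OF that(1) strict_mono_imp_inj_on[OF that(2)]] by (simp add: vimage_def)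
  interpret subseqs P
  proof
    fix k and t :: "nat \<Rightarrow> nat" assume t: "strict_mono t"
    obtain r s :: rat where rs: "from_nat k = (r, s)" by (cases "from_nat k :: rat \<times> rat") auto
    show "\<exists>u. strict_mono u \<and> P k (t \<circ> u)"
    proof (cases "r < s")
      case False
      then show ?thesis using strict_mono_id by (auto simp: P_def rs)
    next
      case True
      have "infinite (range t)"
        using t strict_mono_imp_inj_on finite_imageD infinite_UNIV_nat by blast
      then have "\<not> oscillates (\<lambda>n. {\<phi>. of_rat s < blinfun_apply \<phi> (x n)})
          (\<lambda>n. {\<phi>. blinfun_apply \<phi> (x n) < of_rat r}) (range t) {\<phi> :: 'a \<Rightarrow>\<^sub>L real. norm \<phi> \<le> 1}"
        using neg that[of "of_rat r" "of_rat s" "range t"] True by (auto simp: of_rat_less)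
      then obtain N where N: "N \<subseteq> range t" "infinite N"
        "\<And>\<phi> :: 'a \<Rightarrow>\<^sub>L real. norm \<phi> \<le> 1 \<Longrightarrow>
          finite {n\<in>N. of_rat s < blinfun_apply \<phi> (x n)} \<or> finite {n\<in>N. blinfun_apply \<phi> (x n) < of_rat r}"
        unfolding oscillates_def by auto
      \<comment> \<open>Enumerating the preimage of \<open>N\<close> turns the witness into a
        further subsequence: \<open>t \<circ> u\<close> takes its values in
        \<open>N\<close>.\<close>
      define u where "u = enumerate (t -` N)"
      have infN: "infinite (t -` N)"
        using N(1,2) by (metis finite_imageI image_vimage_eq inf.absorb1)
      have u: "strict_mono u"
        unfolding u_def using infN by (rule strict_mono_enumerate)
      have tuN: "t (u n) \<in> N" for n
        using enumerate_in_set[OF infN, of n] by (simp add: u_def)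
      have inj: "inj (\<lambda>n. t (u n))"
        using strict_mono_imp_inj_on[OF strict_mono_o[OF t u]] by (simp add: o_def)
      have pre: "finite {n. R (x ((t \<circ> u) n))}" if "finite {n\<in>N. R (x n)}" for R
        using finite_vimageI[OF that inj] by (simp add: vimage_def tuN)
      have "finite {n. of_rat s < blinfun_apply \<phi> (x ((t \<circ> u) n))} \<or>
          finite {n. blinfun_apply \<phi> (x ((t \<circ> u) n)) < of_rat r}" if "norm \<phi> \<le> 1" for \<phi> :: "'a \<Rightarrow>\<^sub>L real"
        using N(3)[OF that] by (rule disj_forward) (rule pre, assumption)+
      then have "P k (t \<circ> u)"
        unfolding P_def rs by blast
      with u show ?thesis by blast
    qed
  qed
  \<comment> \<open>Only the tail of the diagonal is known to refine the subsequence chosen for gap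
    \<open>k\<close>; \<open>shift\<close> restores the finitely many missing terms.\<close>
  have D: "P k (diagseq \<circ> (+) (Suc k))" for k
  proof (rule diagseq_holds)
    fix \<rho> t :: "nat \<Rightarrow> nat" and k assume "strict_mono \<rho>" "P k t"
    have sub: "finite {n. R (x ((t \<circ> \<rho>) n))}" if "finite {n. R (x (t n))}" for R
      using fin_pre[OF that \<open>strict_mono \<rho>\<close>] by simp
    show "P k (t \<circ> \<rho>)"
      unfolding P_def
    proof (intro allI impI)
      fix r s :: rat and \<phi> :: "'a \<Rightarrow>\<^sub>L real"
      assume "from_nat k = (r, s)" "r < s" "norm \<phi> \<le> 1"
      with \<open>P k t\<close> have "finite {n. of_rat s < blinfun_apply \<phi> (x (t n))} \<or>
          finite {n. blinfun_apply \<phi> (x (t n)) < of_rat r}"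
        unfolding P_def by blast
      then show "finite {n. of_rat s < blinfun_apply \<phi> (x ((t \<circ> \<rho>) n))} \<or>
          finite {n. blinfun_apply \<phi> (x ((t \<circ> \<rho>) n)) < of_rat r}"
        by (rule disj_forward) (rule sub, assumption)+
    qed
  qed
  have shift: "finite {n. R n}" if "finite {n. R (k + n)}" for R :: "nat \<Rightarrow> bool" and k
  proof -
    have "{n. R n} \<subseteq> {..k} \<union> (+) k ` {n. R (k + n)}"
      by (auto simp: image_iff) (metis le_add_diff_inverse nat_le_linear)
    then show ?thesis using that finite_subset by auto
  qed
  have unit: "convergent (\<lambda>n. blinfun_apply \<phi> (x (diagseq n)))" if \<phi>: "norm \<phi> \<le> 1" for \<phi> :: "'a \<Rightarrow>\<^sub>L real"
  proof (rule convergent_if_no_rational_oscillation)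
    have "bounded (blinfun_apply \<phi> ` range x)"
      by (rule bounded_linear_image[OF bdd blinfun.bounded_linear_right])
    then show "bounded (range (\<lambda>n. blinfun_apply \<phi> (x (diagseq n))))"
      by (rule bounded_subset) auto
    fix r s :: rat assume "r < s"
    define k where "k = to_nat (r, s)"
    show "finite {n. of_rat s < blinfun_apply \<phi> (x (diagseq n))} \<or> finite {n. blinfun_apply \<phi> (x (diagseq n)) < of_rat r}"
      using D[of k] \<phi> \<open>r < s\<close> shift[where k = "Suc k" and R = "\<lambda>n. of_rat s < blinfun_apply \<phi> (x (diagseq n))"]
        shift[where k = "Suc k" and R = "\<lambda>n. blinfun_apply \<phi> (x (diagseq n)) < of_rat r"]
      unfolding P_def k_def by auto
  qed
  have "weakly_Cauchy (x \<circ> diagseq)"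
    unfolding weakly_Cauchy_def
  proof
    fix \<phi> :: "'a \<Rightarrow>\<^sub>L real"
    \<comment> \<open>Scaling by \<open>1 + norm \<phi>\<close> rather than
      \<open>norm \<phi>\<close> keeps the factor invertible for \<open>\<phi> = 0\<close>.\<close>
    define c where "c = 1 + norm \<phi>"
    have c: "c > 0" "norm \<phi> \<le> c" by (auto simp: c_def add_pos_nonneg)
    then have "norm (inverse c *\<^sub>R \<phi>) \<le> 1" by (simp add: field_simps)
    from convergent_mult[OF convergent_const[of c] unit[OF this]]
    have "convergent (\<lambda>n. blinfun_apply \<phi> (x (diagseq n)))"
      using c by (simp add: blinfun.scaleR_left mult.assoc[symmetric])
    then show "Cauchy (\<lambda>n. \<phi> ((x \<circ> diagseq) n))"
      by (simp add: convergent_Cauchy)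
  qed
  with no[OF subseq_diagseq] show False by blast
qed

section \<open>Averaging over sign patterns\<close>

text \<open>These are the Rademacher functions: a sign pattern on \<open>{..<N}\<close> is coded by
  the set of places where it is \<open>1\<close>, so averages over patterns become sums over
  \<open>Pow {..<N}\<close>.\<close>

definition sign_at :: "nat \<Rightarrow> nat set \<Rightarrow> real" where
  "sign_at i S = (if i \<in> S then 1 else - 1)"

text \<open>Flipping one sign is an involution of the patterns; this symmetry cancels single signs
  and mixed products below.\<close>

lemma sum_flip:
  assumes "i < N"
  shows "(\<Sum>S\<in>Pow {..<N}. f (sym_diff S {i})) = (\<Sum>S\<in>Pow {..<N}. f S)"
  by (rule sum.reindex_bij_witness[where i = "\<lambda>S. sym_diff S {i}" and j = "\<lambda>S. sym_diff S {i}"])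
    (use assms in auto)

lemma sign_at_flip: "sign_at i (sym_diff S {i}) = - sign_at i S"
  by (simp add: sign_at_def)

lemma sum_sign_at:
  assumes "i < N"
  shows "(\<Sum>S\<in>Pow {..<N}. sign_at i S) = 0"
  using sum_flip[OF assms, of "sign_at i"] by (simp add: sign_at_flip sum_negf)

lemma sign_at_orthogonal:
  assumes "i < N" "j < N"
  shows "(\<Sum>S\<in>Pow {..<N}. sign_at i S * sign_at j S) = (if i = j then 2 ^ N else 0)"
proof (cases "i = j")
  case True
  then have "(\<Sum>S\<in>Pow {..<N}. sign_at i S * sign_at j S) = (\<Sum>S\<in>Pow {..<N}. 1)"
    by (intro sum.cong) (auto simp: sign_at_def)
  then show ?thesis using True by (simp add: card_Pow)
next
  case False
  then have "sign_at j (sym_diff S {i}) = sign_at j S" for S by (auto simp: sign_at_def)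
  then show ?thesis
    using False sum_flip[OF assms(1), of "\<lambda>S. sign_at i S * sign_at j S"]
    by (simp add: sign_at_flip sum_negf)
qed

lemma sign_at_Bessel:
  "(\<Sum>i<N. (\<Sum>S\<in>Pow {..<N}. sign_at i S * f S)\<^sup>2) \<le> 2 ^ N * (\<Sum>S\<in>Pow {..<N}. (f S)\<^sup>2)"
proof -
  define c where "c i = (\<Sum>S\<in>Pow {..<N}. sign_at i S * f S)" for i
  define g where "g S = (\<Sum>i<N. c i * sign_at i S)" for S
  have fg: "(\<Sum>S\<in>Pow {..<N}. f S * g S) = (\<Sum>i<N. (c i)\<^sup>2)"
  proof -
    have "(\<Sum>S\<in>Pow {..<N}. f S * g S) = (\<Sum>S\<in>Pow {..<N}. \<Sum>i<N. c i * (sign_at i S * f S))"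
      by (simp add: g_def sum_distrib_left mult_ac)
    also have "\<dots> = (\<Sum>i<N. \<Sum>S\<in>Pow {..<N}. c i * (sign_at i S * f S))"
      by (rule sum.swap)
    finally show ?thesis by (simp add: c_def power2_eq_square flip: sum_distrib_left)
  qed
  have gg: "(\<Sum>S\<in>Pow {..<N}. g S * g S) = 2 ^ N * (\<Sum>i<N. (c i)\<^sup>2)"
  proof -
    have "(\<Sum>S\<in>Pow {..<N}. g S * g S) =
        (\<Sum>S\<in>Pow {..<N}. \<Sum>i<N. \<Sum>j<N. c i * c j * (sign_at i S * sign_at j S))"
      by (simp add: g_def sum_product mult_ac)
    also have "\<dots> = (\<Sum>i<N. \<Sum>j<N. \<Sum>S\<in>Pow {..<N}. c i * c j * (sign_at i S * sign_at j S))"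
      by (subst sum.swap) (intro sum.cong refl sum.swap)
    also have "\<dots> = (\<Sum>i<N. \<Sum>j<N. if i = j then c i * c j * 2 ^ N else 0)"
      by (intro sum.cong refl) (simp add: sign_at_orthogonal flip: sum_distrib_left)
    finally show ?thesis
      by (simp add: sum_distrib_left power2_eq_square mult_ac)
  qed
  \<comment> \<open>By orthogonality \<open>g\<close> is \<open>2 ^ N\<close> times the projection
    of \<open>f\<close> onto the span of the signs, so this is the squared norm of a multiple of the
    residual.\<close>
  have "0 \<le> (\<Sum>S\<in>Pow {..<N}. (2 ^ N * f S - g S)\<^sup>2)" by (intro sum_nonneg) simp
  also have "\<dots> = (\<Sum>S\<in>Pow {..<N}. 2 ^ N * (2 ^ N * (f S)\<^sup>2) - 2 * 2 ^ N * (f S * g S) + g S * g S)"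
    by (intro sum.cong refl) (simp add: power2_eq_square algebra_simps)
  also have "\<dots> = 2 ^ N * (2 ^ N * (\<Sum>S\<in>Pow {..<N}. (f S)\<^sup>2)) - 2 * 2 ^ N * (\<Sum>i<N. (c i)\<^sup>2)
      + 2 ^ N * (\<Sum>i<N. (c i)\<^sup>2)"
    by (simp only: sum.distrib sum_subtractf sum_distrib_left[symmetric] fg gg)
  also have "\<dots> = 2 ^ N * (2 ^ N * (\<Sum>S\<in>Pow {..<N}. (f S)\<^sup>2) - (\<Sum>i<N. (c i)\<^sup>2))"
    by (simp add: algebra_simps)
  finally have "2 ^ N * 0 \<le> 2 ^ N * (2 ^ N * (\<Sum>S\<in>Pow {..<N}. (f S)\<^sup>2) - (\<Sum>i<N. (c i)\<^sup>2))"
    by simp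
  then have "0 \<le> 2 ^ N * (\<Sum>S\<in>Pow {..<N}. (f S)\<^sup>2) - (\<Sum>i<N. (c i)\<^sup>2)"
    by (rule mult_left_le_imp_le) simp
  then show ?thesis by (simp add: c_def)
qed

text \<open>Bessel costs a factor \<open>2 ^ N\<close> and the sum over patterns another; the
  squared averaging factor cancels both.\<close>

lemma finite_l2_bounded_functionals:
  fixes x :: "nat \<Rightarrow> 'a::real_normed_vector"
  assumes "\<And>S. S \<subseteq> {..<N} \<Longrightarrow> \<exists>\<psi> :: 'a \<Rightarrow>\<^sub>L real. norm \<psi> \<le> 1 \<and>
    (\<forall>i<N. (i \<in> S \<longrightarrow> s \<le> blinfun_apply \<psi> (x i)) \<and> (i \<notin> S \<longrightarrow> blinfun_apply \<psi> (x i) \<le> r))"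
  shows "\<exists>\<phi> :: nat \<Rightarrow> 'a \<Rightarrow>\<^sub>L real. (\<forall>i<N. (s - r) / 2 \<le> blinfun_apply (\<phi> i) (x i)) \<and>
    (\<forall>z. (\<Sum>i<N. (blinfun_apply (\<phi> i) z)\<^sup>2) \<le> (norm z)\<^sup>2)"
proof -
  obtain \<psi> :: "nat set \<Rightarrow> 'a \<Rightarrow>\<^sub>L real" where \<psi>: "\<And>S. S \<subseteq> {..<N} \<Longrightarrow> norm (\<psi> S) \<le> 1"
    "\<And>S i. S \<subseteq> {..<N} \<Longrightarrow> i < N \<Longrightarrow> i \<in> S \<Longrightarrow> s \<le> blinfun_apply (\<psi> S) (x i)"
    "\<And>S i. S \<subseteq> {..<N} \<Longrightarrow> i < N \<Longrightarrow> i \<notin> S \<Longrightarrow> blinfun_apply (\<psi> S) (x i) \<le> r"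
    using assms by metis
  define \<phi> where "\<phi> i = (1 / 2 ^ N) *\<^sub>R (\<Sum>S\<in>Pow {..<N}. sign_at i S *\<^sub>R \<psi> S)" for i
  have apply_\<phi>: "blinfun_apply (\<phi> i) z = (\<Sum>S\<in>Pow {..<N}. sign_at i S * blinfun_apply (\<psi> S) z) / 2 ^ N" for i z
    by (simp add: \<phi>_def blinfun.scaleR_left blinfun.sum_left)
  show ?thesis
  proof (intro exI[of _ \<phi>] conjI allI impI)
    fix i assume i: "i < N"
    have "2 ^ N * ((s - r) / 2) = (\<Sum>S\<in>Pow {..<N}. (s - r) / 2)"
      by (simp add: card_Pow)
    \<comment> \<open>Signs have mean zero, so subtracting the midpoint \<open>(r + s) / 2\<close>
      leaves the sum unchanged; afterwards each pattern alone contributes at least half the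
      gap.\<close>
    also have "\<dots> \<le> (\<Sum>S\<in>Pow {..<N}. sign_at i S * (blinfun_apply (\<psi> S) (x i) - (r + s) / 2))"
    proof (rule sum_mono)
      fix S assume "S \<in> Pow {..<N}"
      then show "(s - r) / 2 \<le> sign_at i S * (blinfun_apply (\<psi> S) (x i) - (r + s) / 2)"
        using \<psi>(2)[of S i] \<psi>(3)[of S i] i by (cases "i \<in> S") (auto simp: sign_at_def field_simps)
    qed
    also have "\<dots> = (\<Sum>S\<in>Pow {..<N}. sign_at i S * blinfun_apply (\<psi> S) (x i))
        - (\<Sum>S\<in>Pow {..<N}. sign_at i S) * ((r + s) / 2)"
      by (simp only: right_diff_distrib sum_subtractf sum_distrib_right)
    finally show "(s - r) / 2 \<le> blinfun_apply (\<phi> i) (x i)"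
      by (simp add: sum_sign_at[OF i] apply_\<phi> field_simps)
  next
    fix z
    have "(\<Sum>S\<in>Pow {..<N}. (blinfun_apply (\<psi> S) z)\<^sup>2) \<le> (\<Sum>S\<in>Pow {..<N}. (norm z)\<^sup>2)"
    proof (rule sum_mono)
      fix S assume "S \<in> Pow {..<N}"
      then have "norm (\<psi> S) * norm z \<le> 1 * norm z" using \<psi>(1) by (intro mult_right_mono) auto
      then have "\<bar>blinfun_apply (\<psi> S) z\<bar> \<le> norm z"
        using norm_blinfun[of "\<psi> S" z] by simp
      then show "(blinfun_apply (\<psi> S) z)\<^sup>2 \<le> (norm z)\<^sup>2"
        by (simp add: abs_le_square_iff[symmetric])
    qed
    also have "\<dots> = 2 ^ N * (norm z)\<^sup>2" by (simp add: card_Pow)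
    finally have le: "(\<Sum>S\<in>Pow {..<N}. (blinfun_apply (\<psi> S) z)\<^sup>2) \<le> 2 ^ N * (norm z)\<^sup>2" .
    have "(\<Sum>i<N. (blinfun_apply (\<phi> i) z)\<^sup>2) =
        (\<Sum>i<N. (\<Sum>S\<in>Pow {..<N}. sign_at i S * blinfun_apply (\<psi> S) z)\<^sup>2) / (2 ^ N)\<^sup>2"
      by (simp only: apply_\<phi> power_divide flip: sum_divide_distrib)
    also have "\<dots> \<le> (2 ^ N * (2 ^ N * (norm z)\<^sup>2)) / (2 ^ N)\<^sup>2"
      by (intro divide_right_mono order_trans[OF sign_at_Bessel] mult_left_mono le) auto
    also have "\<dots> = (norm z)\<^sup>2" by (simp add: power2_eq_square)
    finally show "(\<Sum>i<N. (blinfun_apply (\<phi> i) z)\<^sup>2) \<le> (norm z)\<^sup>2" .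
  qed
qed

section \<open>Compactness: from finite families to a sequence\<close>

lemma compact_coordinate_box:
  "compact {g :: 'i \<Rightarrow> real. \<forall>i. \<bar>g i\<bar> \<le> b i}"
proof -
  have "compactin (product_topology (\<lambda>i. euclideanreal) UNIV) (PiE UNIV (\<lambda>i. {- b i..b i}))"
    by (simp add: compactin_PiE)
  moreover have "PiE UNIV (\<lambda>i. {- b i..b i}) = {g :: 'i \<Rightarrow> real. \<forall>i. \<bar>g i\<bar> \<le> b i}"
    by (auto simp: PiE_def Pi_def abs_le_iff) (smt (verit))+
  ultimately show ?thesis
    by (simp add: euclidean_product_topology)
qed

text \<open>The families for different \<open>N\<close> need not extend each other. As in the
  Banach-Alaoglu theorem, a sequence is a point \<open>g\<close> of a product of intervals, compact
  by Tychonoff, and the requirements for each \<open>N\<close> form a closed set \<open>F N\<close>;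
  the finite case supplies the finite intersection property.\<close>

lemma l2_bounded_functionals:
  fixes x :: "nat \<Rightarrow> 'a::real_normed_vector"
  assumes "\<And>N S. S \<subseteq> {..<N} \<Longrightarrow> \<exists>\<psi> :: 'a \<Rightarrow>\<^sub>L real. norm \<psi> \<le> 1 \<and>
    (\<forall>i<N. (i \<in> S \<longrightarrow> s \<le> blinfun_apply \<psi> (x i)) \<and> (i \<notin> S \<longrightarrow> blinfun_apply \<psi> (x i) \<le> r))"
  obtains \<phi> :: "nat \<Rightarrow> 'a \<Rightarrow>\<^sub>L real" where "\<And>i. (s - r) / 2 \<le> blinfun_apply (\<phi> i) (x i)"
    "\<And>N z. (\<Sum>i<N. (blinfun_apply (\<phi> i) z)\<^sup>2) \<le> (norm z)\<^sup>2"
proof -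
  define box where "box = {g :: nat \<times> 'a \<Rightarrow> real. \<forall>k. \<bar>g k\<bar> \<le> norm (snd k)}"
  define F where "F N = {g :: nat \<times> 'a \<Rightarrow> real.
      (\<forall>i y z. g (i, y + z) = g (i, y) + g (i, z)) \<and> (\<forall>i c z. g (i, c *\<^sub>R z) = c * g (i, z)) \<and>
      (\<forall>i. i < N \<longrightarrow> (s - r) / 2 \<le> g (i, x i)) \<and> (\<forall>z. (\<Sum>i<N. (g (i, z))\<^sup>2) \<le> (norm z)\<^sup>2)}" for N
  have "box \<inter> (\<Inter>N\<in>UNIV. F N) \<noteq> {}"
  proof (rule compact_imp_fip_image)
    show "compact box" unfolding box_def by (rule compact_coordinate_box)
    show "closed (F N)" for N
      unfolding F_def
      by (intro closed_Collect_conj closed_Collect_all closed_Collect_imp closed_Collect_eq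
          closed_Collect_le open_Collect_const continuous_intros continuous_on_product_coordinates)
    fix I :: "nat set" assume "finite I"
    then obtain N where N: "\<And>n. n \<in> I \<Longrightarrow> n \<le> N" using finite_nat_set_iff_bounded_le by auto
    obtain \<phi> :: "nat \<Rightarrow> 'a \<Rightarrow>\<^sub>L real" where \<phi>:
      "\<And>i. i < N \<Longrightarrow> (s - r) / 2 \<le> blinfun_apply (\<phi> i) (x i)"
      "\<And>z. (\<Sum>i<N. (blinfun_apply (\<phi> i) z)\<^sup>2) \<le> (norm z)\<^sup>2"
      using finite_l2_bounded_functionals[of N s x r, OF assms] by blast
    \<comment> \<open>Padding by zero beyond \<open>N\<close> keeps linearity and the box bound at
      every index.\<close>
    define g where "g = (\<lambda>(i, z). if i < N then blinfun_apply (\<phi> i) z else 0)"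
    have part: "(\<Sum>i<n. (g (i, z))\<^sup>2) \<le> (norm z)\<^sup>2" if "n \<le> N" for n z
    proof -
      have "(\<Sum>i<n. (g (i, z))\<^sup>2) \<le> (\<Sum>i<N. (g (i, z))\<^sup>2)"
        by (rule sum_mono2) (use that in auto)
      also have "\<dots> \<le> (norm z)\<^sup>2" using \<phi>(2)[of z] by (simp add: g_def)
      finally show ?thesis .
    qed
    have "\<bar>g k\<bar> \<le> norm (snd k)" for k
    proof -
      obtain i z where k: "k = (i, z)" by (cases k)
      have "(g (i, z))\<^sup>2 \<le> (norm z)\<^sup>2"
      proof (cases "i < N")
        case True
        then have "(g (i, z))\<^sup>2 \<le> (\<Sum>i<N. (g (i, z))\<^sup>2)"
          by (intro member_le_sum) auto
        then show ?thesis using part[of N z] by simp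
      qed (simp add: g_def)
      then show ?thesis by (simp add: k abs_le_square_iff[symmetric])
    qed
    moreover have "g \<in> F n" if "n \<in> I" for n
      using N[OF that] part[of n] \<phi>(1)
      by (auto simp: F_def g_def blinfun.add_right blinfun.scaleR_right)
    ultimately have "g \<in> box \<inter> (\<Inter>N\<in>I. F N)" unfolding box_def by blast
    then show "box \<inter> (\<Inter>N\<in>I. F N) \<noteq> {}" by blast
  qed
  then obtain g where g: "g \<in> box" "\<And>N. g \<in> F N" by auto
  define \<phi> where "\<phi> i = Blinfun (\<lambda>z. g (i, z))" for i
  have "bounded_linear (\<lambda>z. g (i, z))" for i
    by (rule bounded_linear_intro[where K = 1])
      (use g(1) g(2)[of 0] in \<open>auto simp: box_def F_def\<close>)
  then have \<phi>: "blinfun_apply (\<phi> i) z = g (i, z)" for i z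
    by (simp add: \<phi>_def bounded_linear_Blinfun_apply)
  show thesis
  proof (rule that[of \<phi>])
    show "(s - r) / 2 \<le> blinfun_apply (\<phi> i) (x i)" for i
      \<comment> \<open>\<open>F N\<close> gives lower bounds only at indices below
        \<open>N\<close>, hence \<open>Suc i\<close>.\<close>
      using g(2)[of "Suc i"] by (simp add: \<phi> F_def)
    show "(\<Sum>i<N. (blinfun_apply (\<phi> i) z)\<^sup>2) \<le> (norm z)\<^sup>2" for N z
      using g(2)[of N] by (simp add: \<phi> F_def)
  qed
qed

section \<open>Weakly summable sequences of functionals\<close>

text \<open>This is the common source of both contradictions. The points are pulled back to
  \<open>y i\<close> because compactness and the norm of the adjoint are tested on the unit ball of
  the domain.\<close>

lemma not_weakly_precompact_imp_functionals:
  fixes T :: "'y::real_normed_vector \<Rightarrow>\<^sub>L 'x::real_normed_vector"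
  assumes "\<not> weakly_precompact T"
  obtains \<delta> and y :: "nat \<Rightarrow> 'y" and \<phi> :: "nat \<Rightarrow> 'x \<Rightarrow>\<^sub>L real" where
    "\<delta> > 0" "\<And>i. norm (y i) \<le> 1" "\<And>i. \<delta> \<le> blinfun_apply (\<phi> i) (T (y i))"
    "\<And>N z. (\<Sum>i<N. (blinfun_apply (\<phi> i) z)\<^sup>2) \<le> (norm z)\<^sup>2"
proof -
  obtain x where x: "range x \<subseteq> T ` cball 0 1"
    "\<And>t. strict_mono (t :: nat \<Rightarrow> nat) \<Longrightarrow> \<not> weakly_Cauchy (x \<circ> t)"
    using assms unfolding weakly_precompact_def by blast
  have "bounded (T ` cball 0 1)"
    by (rule bounded_linear_image[OF bounded_cball blinfun.bounded_linear_right])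
  then have "bounded (range x)" by (rule bounded_subset[OF _ x(1)])
  from no_weakly_Cauchy_imp_oscillates[OF this x(2)] obtain r s :: real and M where
    rs: "r < s" and M: "infinite M"
      "oscillates (\<lambda>n. {\<phi>. s < blinfun_apply \<phi> (x n)}) (\<lambda>n. {\<phi>. blinfun_apply \<phi> (x n) < r}) M
        {\<phi> :: 'x \<Rightarrow>\<^sub>L real. norm \<phi> \<le> 1}"
    by blast
  from oscillates_imp_independent[OF M] obtain m :: "nat \<Rightarrow> nat" where m:
    "\<forall>N \<sigma>. {\<phi> :: 'x \<Rightarrow>\<^sub>L real. norm \<phi> \<le> 1} \<inter> (\<Inter>i<N. if \<sigma> i then {\<phi>. s < blinfun_apply \<phi> (x (m i))}
      else {\<phi>. blinfun_apply \<phi> (x (m i)) < r}) \<noteq> {}"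
    by (elim exE conjE)
  have "\<exists>\<psi> :: 'x \<Rightarrow>\<^sub>L real. norm \<psi> \<le> 1 \<and>
      (\<forall>i<N. (i \<in> S \<longrightarrow> s \<le> blinfun_apply \<psi> (x (m i))) \<and> (i \<notin> S \<longrightarrow> blinfun_apply \<psi> (x (m i)) \<le> r))"
    for N and S :: "nat set"
  proof -
    obtain \<psi> where "\<psi> \<in> {\<phi> :: 'x \<Rightarrow>\<^sub>L real. norm \<phi> \<le> 1} \<inter>
        (\<Inter>i<N. if i \<in> S then {\<phi>. s < blinfun_apply \<phi> (x (m i))} else {\<phi>. blinfun_apply \<phi> (x (m i)) < r})"
      using m[THEN spec[of _ N], THEN spec[of _ "\<lambda>i. i \<in> S"]] by (metis (no_types, lifting) ex_in_conv)
    then have \<psi>: "norm \<psi> \<le> 1"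
      "\<And>i. i < N \<Longrightarrow> if i \<in> S then s < blinfun_apply \<psi> (x (m i)) else blinfun_apply \<psi> (x (m i)) < r"
      by (auto split: if_splits)
    show ?thesis
      using \<psi> by (intro exI[of _ \<psi>]) (meson less_imp_le)
  qed
  from l2_bounded_functionals[of s "\<lambda>i. x (m i)" r, OF this] obtain \<phi> :: "nat \<Rightarrow> 'x \<Rightarrow>\<^sub>L real" where \<phi>:
    "\<And>i. (s - r) / 2 \<le> blinfun_apply (\<phi> i) (x (m i))"
    "\<And>N z. (\<Sum>i<N. (blinfun_apply (\<phi> i) z)\<^sup>2) \<le> (norm z)\<^sup>2"
    by blast
  have "\<exists>y. norm y \<le> 1 \<and> x (m i) = T y" for i
    using x(1)[THEN subsetD, OF rangeI, of "m i"] by auto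
  then obtain y where "\<And>i. norm (y i) \<le> 1 \<and> x (m i) = T (y i)" by metis
  with \<phi> rs show thesis by (intro that[of "(s - r) / 2" y \<phi>]) auto
qed

text \<open>All terms are bounded by \<open>c\<close>, so \<open>p - 2\<close> of the powers can be
  traded for the constant \<open>c powr (p - 2)\<close>. The explicit norm bound serves the
  continuity of \<open>J\<close>.\<close>

lemma lp_bound_of_l2_bound:
  fixes a :: "nat \<Rightarrow> real"
  assumes p: "2 \<le> p" and c: "0 \<le> c" and le: "\<And>N. (\<Sum>i<N. (a i)\<^sup>2) \<le> c\<^sup>2"
  shows "a \<in> lp_space p" and "lp_norm p a \<le> c"
proof -
  have ac: "\<bar>a n\<bar> \<le> c" for n
  proof -
    have "(a n)\<^sup>2 \<le> (\<Sum>i<Suc n. (a i)\<^sup>2)" by (simp add: sum_nonneg)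
    also have "\<dots> \<le> c\<^sup>2" by (rule le)
    finally show ?thesis using c by (simp add: abs_le_square_iff[symmetric])
  qed
  have bound: "\<bar>a n\<bar> powr p \<le> c powr (p - 2) * (a n)\<^sup>2" for n
  proof (cases "a n = 0")
    case False
    then have "\<bar>a n\<bar> powr p = \<bar>a n\<bar> powr (p - 2) * \<bar>a n\<bar> powr 2"
      using powr_add[of "\<bar>a n\<bar>" "p - 2" 2] by simp
    also have "\<dots> \<le> c powr (p - 2) * \<bar>a n\<bar> powr 2"
      using p ac by (intro mult_right_mono powr_mono2) auto
    finally show ?thesis using False by simp
  qed simp
  have part: "(\<Sum>i<N. \<bar>a i\<bar> powr p) \<le> c powr p" for N
  proof -
    have "(\<Sum>i<N. \<bar>a i\<bar> powr p) \<le> c powr (p - 2) * (\<Sum>i<N. (a i)\<^sup>2)"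
      unfolding sum_distrib_left by (intro sum_mono bound)
    also have "\<dots> \<le> c powr (p - 2) * c\<^sup>2" by (intro mult_left_mono le) auto
    also have "\<dots> = c powr p"
    proof (cases "c = 0")
      case False
      then have "c powr p = c powr (p - 2) * c powr 2"
        using powr_add[of "c" "p - 2" 2] by simp
      then show ?thesis using c False by simp
    qed simp
    finally show ?thesis .
  qed
  have sum: "summable (\<lambda>n. \<bar>a n\<bar> powr p)"
    using part by (intro summableI_nonneg_bounded) auto
  then show "a \<in> lp_space p" by (simp add: lp_space_def)
  have "(\<Sum>n. \<bar>a n\<bar> powr p) powr (1 / p) \<le> (c powr p) powr (1 / p)"
    using p sum part by (intro powr_mono2 suminf_le_const) (auto intro: suminf_nonneg)
  then show "lp_norm p a \<le> c" using p c by (simp add: lp_norm_def powr_powr)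
qed

lemma lp_space_tendsto_0:
  assumes "a \<in> lp_space p" "0 < p"
  shows "a \<longlonglongrightarrow> 0"
proof -
  have "(\<lambda>n. \<bar>a n\<bar> powr p) \<longlonglongrightarrow> 0"
    using assms(1) by (intro summable_LIMSEQ_zero) (simp add: lp_space_def)
  then have "(\<lambda>n. (\<bar>a n\<bar> powr p) powr (1 / p)) \<longlonglongrightarrow> 0"
    by (rule tendsto_zero_powrI[OF _ tendsto_const]) (use assms(2) in auto)
  then show ?thesis
    using assms(2) by (simp add: powr_powr tendsto_rabs_zero_iff)
qed

lemma abs_coordinate_le_lp_norm:
  assumes "1 \<le> p" "a \<in> lp_space p"
  shows "\<bar>a n\<bar> \<le> lp_norm p a"
proof -
  have "(\<bar>a n\<bar> powr p) powr (1 / p) \<le> (\<Sum>i. \<bar>a i\<bar> powr p) powr (1 / p)"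
    using assms sum_le_suminf[of "\<lambda>i. \<bar>a i\<bar> powr p" "{n}"]
    by (intro powr_mono2) (auto simp: lp_space_def)
  then show ?thesis using assms(1) by (simp add: powr_powr lp_norm_def)
qed

text \<open>The norm bound makes this linear map nonexpansive, so balls of equal radius witness
  continuity.\<close>

lemma lp_operator_of_l2_bounded_functionals:
  fixes \<phi> :: "nat \<Rightarrow> 'x::real_normed_vector \<Rightarrow>\<^sub>L real"
  assumes p: "2 \<le> p" and \<phi>: "\<And>N z. (\<Sum>i<N. (blinfun_apply (\<phi> i) z)\<^sup>2) \<le> (norm z)\<^sup>2"
  shows "lp_operator p (\<lambda>z n. blinfun_apply (\<phi> n) z)"
proof -
  interpret Metric_space "lp_space p" "lp_dist p" by (rule Metric_space_lp) (use p in simp)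
  have mem: "(\<lambda>n. blinfun_apply (\<phi> n) z) \<in> lp_space p"
    and le: "lp_norm p (\<lambda>n. blinfun_apply (\<phi> n) z) \<le> norm z" for z
    using lp_bound_of_l2_bound[OF p norm_ge_zero \<phi>] by auto
  have "continuous_map euclidean mtopology (\<lambda>z n. blinfun_apply (\<phi> n) z)"
    unfolding continuous_map_to_metric
  proof (intro ballI allI impI)
    fix z :: 'x and e :: real assume "e > 0"
    have "lp_dist p (\<lambda>n. blinfun_apply (\<phi> n) z) (\<lambda>n. blinfun_apply (\<phi> n) w) \<le> dist z w" for w
      using le[of "z - w"] by (simp add: lp_dist_def blinfun.diff_right dist_norm)
    then show "\<exists>U. openin euclidean U \<and> z \<in> U \<and>
        (\<forall>w\<in>U. (\<lambda>n. blinfun_apply (\<phi> n) w) \<in> mball (\<lambda>n. blinfun_apply (\<phi> n) z) e)"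
      using \<open>e > 0\<close> mem by (intro exI[of _ "ball z e"]) (force dest: le_less_trans)
  qed
  then have "continuous_map euclidean (lp_topology p) (\<lambda>z n. blinfun_apply (\<phi> n) z)"
    by (simp add: lp_topology_def)
  then show ?thesis
    unfolding lp_operator_def
    using bounded_linear.linear[OF blinfun.bounded_linear_right] by blast
qed

text \<open>Along a subsequence \<open>t\<close> of the images converging to \<open>l\<close>, the
  diagonal entry is at most the distance to \<open>l\<close> plus \<open>l (t i)\<close>. Both tend
  to 0, the latter because \<open>l\<close> lies in the sequence space.\<close>

lemma lp_compact_imp_diagonal_not_bounded_below:
  fixes S :: "'y::real_normed_vector \<Rightarrow> nat \<Rightarrow> real"
  assumes p: "1 \<le> p" and cpt: "lp_compact p S" and S: "\<And>y. S y \<in> lp_space p"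
    and y: "\<And>i. norm (y i) \<le> 1" and low: "\<And>i. \<delta> \<le> S (y i) i"
  shows "\<delta> \<le> 0"
proof -
  interpret Metric_space "lp_space p" "lp_dist p" by (rule Metric_space_lp[OF p])
  let ?K = "mtopology closure_of (S ` cball 0 1)"
  have "range (\<lambda>i. S (y i)) \<subseteq> S ` cball 0 1" using y by auto
  also have "\<dots> \<subseteq> ?K" using S by (intro closure_of_subset) auto
  finally have "range (\<lambda>i. S (y i)) \<subseteq> ?K" .
  then obtain l t where t: "strict_mono (t :: nat \<Rightarrow> nat)"
    and lim: "limitin mtopology ((\<lambda>i. S (y i)) \<circ> t) l sequentially"
    using cpt unfolding lp_compact_def lp_topology_def compactin_sequentially by blast
  have l: "l \<in> lp_space p" and d: "(\<lambda>i. lp_dist p (S (y (t i))) l) \<longlonglongrightarrow> 0"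
    using lim by (auto simp: limitin_metric_dist_null)
  have "(\<lambda>i. l (t i)) \<longlonglongrightarrow> 0"
    using LIMSEQ_subseq_LIMSEQ[OF lp_space_tendsto_0[OF l] t] p by (simp add: o_def)
  from tendsto_add[OF d this]
  have "(\<lambda>i. lp_dist p (S (y (t i))) l + l (t i)) \<longlonglongrightarrow> 0" by simp
  moreover have "\<delta> \<le> lp_dist p (S (y (t i))) l + l (t i)" for i
    using abs_coordinate_le_lp_norm[OF p lp_space_diff[OF p S l], of "y (t i)" "t i"] low[of "t i"]
    by (simp add: lp_dist_def)
  ultimately show ?thesis by (intro LIMSEQ_le_const) auto
qed

text \<open>Weak summability in the dual is tested by elements \<open>\<Phi>\<close> of the bidual,
  while the hypothesis concerns vectors \<open>z\<close>. Cauchy-Schwarz turns it into a norm bound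
  for the combination \<open>\<psi>\<close> with coefficients
  \<open>\<Phi> (\<phi> i)\<close>.\<close>

lemma weakly_p_summable_of_l2_bounded_functionals:
  fixes \<phi> :: "nat \<Rightarrow> 'x::real_normed_vector \<Rightarrow>\<^sub>L real"
  assumes p: "2 \<le> p" and \<phi>: "\<And>N z. (\<Sum>i<N. (blinfun_apply (\<phi> i) z)\<^sup>2) \<le> (norm z)\<^sup>2"
  shows "weakly_p_summable p \<phi>"
  unfolding weakly_p_summable_def
proof
  fix \<Phi> :: "('x \<Rightarrow>\<^sub>L real) \<Rightarrow>\<^sub>L real"
  define a where "a i = blinfun_apply \<Phi> (\<phi> i)" for i
  have "(\<Sum>i<N. (a i)\<^sup>2) \<le> (norm \<Phi>)\<^sup>2" for N
  proof -
    define q where "q = sqrt (\<Sum>i<N. (a i)\<^sup>2)"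
    have q: "q \<ge> 0" "q\<^sup>2 = (\<Sum>i<N. (a i)\<^sup>2)" by (simp_all add: q_def sum_nonneg)
    define \<psi> where "\<psi> = (\<Sum>i<N. a i *\<^sub>R \<phi> i)"
    have "norm \<psi> \<le> q"
    proof (rule norm_blinfun_bound[OF q(1)])
      fix z
      have "(\<Sum>i<N. a i * blinfun_apply (\<phi> i) z)\<^sup>2 \<le> (\<Sum>i<N. (a i)\<^sup>2) * (\<Sum>i<N. (blinfun_apply (\<phi> i) z)\<^sup>2)"
        by (rule Cauchy_Schwarz_ineq_sum)
      also have "\<dots> \<le> q\<^sup>2 * (norm z)\<^sup>2"
        unfolding q(2)[symmetric] by (intro mult_left_mono \<phi>) auto
      finally have "(blinfun_apply \<psi> z)\<^sup>2 \<le> (q * norm z)\<^sup>2"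
        by (simp add: \<psi>_def blinfun.sum_left blinfun.scaleR_left power_mult_distrib)
      then show "norm (blinfun_apply \<psi> z) \<le> q * norm z"
        using q(1) by (metis abs_le_square_iff abs_of_nonneg mult_nonneg_nonneg norm_ge_zero real_norm_def)
    qed
    \<comment> \<open>With these coefficients \<open>\<Phi> \<psi>\<close> is exactly
      \<open>q\<^sup>2\<close>, and dividing \<open>q\<^sup>2 \<le> norm \<Phi> * q\<close> by a
      nonzero \<open>q\<close> gives the bound.\<close>
    have "q\<^sup>2 = blinfun_apply \<Phi> \<psi>"
      unfolding q(2) by (simp add: \<psi>_def a_def blinfun.sum_right blinfun.scaleR_right power2_eq_square)
    also have "\<dots> \<le> norm \<Phi> * norm \<psi>" using norm_blinfun[of \<Phi> \<psi>] by simp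
    also have "\<dots> \<le> norm \<Phi> * q" using \<open>norm \<psi> \<le> q\<close> by (intro mult_left_mono) auto
    finally have "q * q \<le> norm \<Phi> * q" by (simp add: power2_eq_square)
    then have "q \<le> norm \<Phi>"
      using q(1) norm_ge_zero[of \<Phi>] by (cases "q = 0") (auto simp del: norm_ge_zero)
    then show ?thesis using q by (metis power_mono)
  qed
  from lp_bound_of_l2_bound(1)[OF p norm_ge_zero this]
  show "(\<lambda>n. blinfun_apply \<Phi> (\<phi> n)) \<in> lp_space p" by (simp add: a_def[abs_def])
qed

theorem theorem16:
  fixes p :: real and T :: "'y::banach \<Rightarrow>\<^sub>L 'x::banach"
  assumes "2 < p"
  shows "((\<forall>J :: 'x \<Rightarrow> nat \<Rightarrow> real. lp_operator p J \<longrightarrow> lp_compact p (\<lambda>y. J (T y)))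
            \<longrightarrow> weakly_precompact T) \<and>
         (p_convergent p (banach_adjoint T) \<longrightarrow> weakly_precompact T)"
proof (rule ccontr)
  assume neg: "\<not> ?thesis"
  then have "\<not> weakly_precompact T" by blast
  from not_weakly_precompact_imp_functionals[OF this] obtain \<delta> and y :: "nat \<Rightarrow> 'y" and \<phi> :: "nat \<Rightarrow> 'x \<Rightarrow>\<^sub>L real" where
    \<delta>: "\<delta> > 0" and y: "\<And>i. norm (y i) \<le> 1" and low: "\<And>i. \<delta> \<le> blinfun_apply (\<phi> i) (T (y i))"
    and l2: "\<And>N z. (\<Sum>i<N. (blinfun_apply (\<phi> i) z)\<^sup>2) \<le> (norm z)\<^sup>2"
    by blast
  have p: "2 \<le> p" "1 \<le> p" using assms by auto
  define J where "J = (\<lambda>z n. blinfun_apply (\<phi> n) z)"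
  have J: "lp_operator p J"
    unfolding J_def by (rule lp_operator_of_l2_bounded_functionals[OF p(1) l2])
  have "\<not> lp_compact p (\<lambda>y. J (T y))"
  proof
    assume "lp_compact p (\<lambda>y. J (T y))"
    from lp_compact_imp_diagonal_not_bounded_below[OF p(2) this, of y \<delta>] y
    show False
      using \<delta> low lp_bound_of_l2_bound(1)[OF p(1) norm_ge_zero l2] by (simp add: J_def)
  qed
  moreover have "\<not> p_convergent p (banach_adjoint T)"
  proof
    assume "p_convergent p (banach_adjoint T)"
    then have "(\<lambda>n. norm (banach_adjoint T (\<phi> n))) \<longlonglongrightarrow> 0"
      using weakly_p_summable_of_l2_bounded_functionals[OF p(1) l2]
      unfolding p_convergent_def by (intro tendsto_norm_zero) blast
    \<comment> \<open>Evaluation at \<open>y n\<close> in the unit ball returns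
      \<open>\<phi> n (T (y n))\<close>, which keeps these norms away from 0.\<close>
    moreover have "\<delta> \<le> norm (banach_adjoint T (\<phi> n))" for n
    proof -
      have "\<delta> \<le> blinfun_apply (banach_adjoint T (\<phi> n)) (y n)"
        using low[of n] by (simp add: banach_adjoint.rep_eq)
      also have "\<dots> \<le> norm (banach_adjoint T (\<phi> n)) * norm (y n)"
        using norm_blinfun[of "banach_adjoint T (\<phi> n)" "y n"] by simp
      also have "\<dots> \<le> norm (banach_adjoint T (\<phi> n))"
        using y[of n] by (simp add: mult_left_le)
      finally show ?thesis .
    qed
    ultimately have "\<delta> \<le> 0" by (intro LIMSEQ_le_const) auto
    then show False using \<delta> by simp
  qed
  ultimately show False using neg J by blast
qed

end
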